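(* Let $d\in\mathbb{N}$. For every $j\in[d]$ assume that there exists a worst-case function $h^{(j)}$ in $F^{(j)}$, and assume that $h_d(\boldsymbol{x})=h^{(1)}(x_1)\cdots h^{(d)}(x_d)$, $\boldsymbol{x}=(x_1,\ldots,x_d)\in D_d$, is a worst-case function in $F_d$. Assume further that for every $j\in[d]$ and every $y\in D^{(j)}$ there exists a function $s_y^{(j)}\in F^{(j)}$ such that $s_y^{(j)}\ge0$ and $s_y^{(j)}(y)=h^{(j)}(y)$. Put $$\alpha_j:=\max_{y\in D^{(j)}}\|s_y^{(j)}\|^{(j)}\quad\text{and}\quad\beta_j:=\max_{y\in D^{(j)}}\int_{D^{(j)}}s_y^{(j)}(x)\,\mathrm{d}x,$$ and $$\boldsymbol{\alpha}:=\prod_{j=1}^d\alpha_j,\qquad\boldsymbol{\beta}:=\prod_{j=1}^d\beta_j,\qquad\widetilde{C}_d:=\min\Big(\frac{\|h_d\|_d}{\boldsymbol{\alpha}},\frac{I_d(h_d)}{\boldsymbol{\beta}}\Big).$$ Then $$N(\varepsilon,d)\ge\widetilde{C}_d\,(1-2\varepsilon)\qquad\text{for all }\varepsilon\in\left(0,\tfrac12\right)\text{ and }d\in\mathbb{N}.$$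
   Context: Notation: $\mathbb{N}=\{1,2,\ldots\}$, $[d]=\{1,\ldots,d\}$. For $j\in\mathbb{N}$ let $(F^{(j)},\|\cdot\|^{(j)})$ be normed spaces of univariate integrable functions over a Borel measurable domain $D^{(j)}\subseteq\mathbb{R}$. For $d\in\mathbb{N}$ let $(F_d,\|\cdot\|_d)$ be the tensor product space $F_d=F^{(1)}\otimes\cdots\otimes F^{(d)}$, consisting of functions on $D_d=D^{(1)}\times\cdots\times D^{(d)}$, equipped with a crossnorm $\|\cdot\|_d$, i.e. for $f(x_1,\ldots,x_d)=f_1(x_1)\cdots f_d(x_d)$ with $f_j\in F^{(j)}$ one has $\|f\|_d=\|f_1\|^{(1)}\cdots\|f_d\|^{(d)}$. Let $I_d(f)=\int_{D_d}f(\boldsymbol{x})\,\mathrm{d}\boldsymbol{x}$ for $f\in F_d$. The initial error is $e(0,d)=\|I_d\|=\sup_{f\in F_d,\,\|f\|_d\le1}|I_d(f)|$; $e_j(0,1)$ denotes the initial error of univariate integration in $F^{(j)}$. A worst-case function in $F^{(j)}$ is a function $h^{(j)}\in F^{(j)}$ with $\int_{D^{(j)}}h^{(j)}(x)\,\mathrm{d}x=\|h^{(j)}\|^{(j)}\,e_j(0,1)$; a worst-case function in $F_d$ is a function $h_d\in F_d$ with $I_d(h_d)=\|h_d\|_d\,e(0,d)$. (Under the assumptions, $e(0,d)=\prod_{j=1}^de_j(0,1)$.) Integrals are approximated by positive linear rules $A_{d,N}(f)=\sum_{k=1}^Na_kf(\boldsymbol{x}_k)$ with $\boldsymbol{x}_1,\ldots,\boldsymbol{x}_N\in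 D_d$ and $a_1,\ldots,a_N\ge0$, with worst-case error $e(F_d,A_{d,N})=\sup_{f\in F_d,\,\|f\|_d\le1}|I_d(f)-A_{d,N}(f)|$. Let $e(N,d)$ be the minimum (understood as an infimum) of $e(F_d,A_{d,N})$ over all such rules with $N$ nodes and non-negative weights, and for $\varepsilon\in(0,1)$ put $$N(\varepsilon,d)=\min\{N\in\mathbb{N}:e(N,d)\le\varepsilon\,e(0,d)\}.$$ *)

theory Defs
  imports "HOL-Analysis.Analysis"
begin

text \<open>
  A function on a domain \<open>X\<close> is represented by its extension by zero to the whole type, so that
  two functions on \<open>X\<close> are equal iff their representatives are. The domain together with its
  Lebesgue measure is given by a measure space \<open>M\<close> with \<open>space M = X\<close>.
\<close>

locale normed_integrable_space =
  fixes M :: "'a measure" and F :: "('a \<Rightarrow> real) set" and nrm :: "('a \<Rightarrow> real) \<Rightarrow> real"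
  assumes vanishes_outside: "f \<in> F \<Longrightarrow> x \<notin> space M \<Longrightarrow> f x = 0"
    and integrable: "f \<in> F \<Longrightarrow> integrable M f"
    and zero_mem: "(\<lambda>_. 0) \<in> F"
    and add_mem: "f \<in> F \<Longrightarrow> g \<in> F \<Longrightarrow> (\<lambda>x. f x + g x) \<in> F"
    and scale_mem: "f \<in> F \<Longrightarrow> (\<lambda>x. c * f x) \<in> F"
    and norm_nonneg: "f \<in> F \<Longrightarrow> 0 \<le> nrm f"
    and norm_eq_0: "f \<in> F \<Longrightarrow> nrm f = 0 \<longleftrightarrow> f = (\<lambda>_. 0)"
    and norm_scale: "f \<in> F \<Longrightarrow> nrm (\<lambda>x. c * f x) = \<bar>c\<bar> * nrm f"
    and norm_triangle: "f \<in> F \<Longrightarrow> g \<in> F \<Longrightarrow> nrm (\<lambda>x. f x + g x) \<le> nrm f + nrm g"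

text \<open>
  Points of \<open>D 1 \<times> \<dots> \<times> D d\<close> are extensional functions on \<open>{1..d}\<close>. The completion makes
  \<open>box_measure d D\<close> the Lebesgue (not only the Borel) measure on that set.
\<close>

definition box_measure :: "nat \<Rightarrow> (nat \<Rightarrow> real set) \<Rightarrow> (nat \<Rightarrow> real) measure" where
  "box_measure d D =
     restrict_space (completion (Pi\<^sub>M {1..d} (\<lambda>_. lborel))) (Pi\<^sub>E {1..d} D)"

definition tensor :: "nat \<Rightarrow> (nat \<Rightarrow> real set) \<Rightarrow> (nat \<Rightarrow> real \<Rightarrow> real) \<Rightarrow> (nat \<Rightarrow> real) \<Rightarrow> real" where
  "tensor d D f = (\<lambda>x. if x \<in> Pi\<^sub>E {1..d} D then \<Prod>j=1..d. f j (x j) else 0)"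

text \<open>Scalar coefficients are absorbed into one of the factors, as \<open>d \<ge> 1\<close> in all uses.\<close>

definition algebraic_tensor_product ::
  "nat \<Rightarrow> (nat \<Rightarrow> real set) \<Rightarrow> (nat \<Rightarrow> (real \<Rightarrow> real) set) \<Rightarrow> ((nat \<Rightarrow> real) \<Rightarrow> real) set" where
  "algebraic_tensor_product d D F =
     {\<lambda>x. \<Sum>i<n. tensor d D (f i) x | (n::nat) f. \<forall>i<n. \<forall>j\<in>{1..d}. f i j \<in> F j}"

text \<open>
  A tensor product space may be the algebraic tensor product itself or any completion of it (full
  or partial) that still consists of integrable functions: it contains the algebraic tensor
  product as a dense subspace.
\<close>

locale tensor_product_space =
  normed_integrable_space "box_measure d D" Fd nrmd
  for d :: nat and D :: "nat \<Rightarrow> real set"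
    and F :: "nat \<Rightarrow> (real \<Rightarrow> real) set" and nrm :: "nat \<Rightarrow> (real \<Rightarrow> real) \<Rightarrow> real"
    and Fd :: "((nat \<Rightarrow> real) \<Rightarrow> real) set" and nrmd :: "((nat \<Rightarrow> real) \<Rightarrow> real) \<Rightarrow> real" +
  assumes algebraic_subset: "algebraic_tensor_product d D F \<subseteq> Fd"
    and algebraic_dense:
      "f \<in> Fd \<Longrightarrow> 0 < e \<Longrightarrow> \<exists>g\<in>algebraic_tensor_product d D F. nrmd (\<lambda>x. f x - g x) < e"
    and crossnorm:
      "(\<And>j. j \<in> {1..d} \<Longrightarrow> p j \<in> F j) \<Longrightarrow> nrmd (tensor d D p) = (\<Prod>j=1..d. nrm j (p j))"

text \<open>Errors are extended reals, since integration need not be a bounded functional.\<close>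

definition initial_error ::
  "'a measure \<Rightarrow> ('a \<Rightarrow> real) set \<Rightarrow> (('a \<Rightarrow> real) \<Rightarrow> real) \<Rightarrow> ereal" where
  "initial_error M F nrm = (SUP f\<in>{f \<in> F. nrm f \<le> 1}. ereal \<bar>integral\<^sup>L M f\<bar>)"

definition worst_case_function ::
  "'a measure \<Rightarrow> ('a \<Rightarrow> real) set \<Rightarrow> (('a \<Rightarrow> real) \<Rightarrow> real) \<Rightarrow> ('a \<Rightarrow> real) \<Rightarrow> bool" where
  "worst_case_function M F nrm h \<longleftrightarrow>
     h \<in> F \<and> ereal (integral\<^sup>L M h) = ereal (nrm h) * initial_error M F nrm"

definition linear_rule :: "nat \<Rightarrow> (nat \<Rightarrow> real) \<Rightarrow> (nat \<Rightarrow> 'a) \<Rightarrow> ('a \<Rightarrow> real) \<Rightarrow> real" where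
  "linear_rule N a x f = (\<Sum>k=1..N. a k * f (x k))"

definition worst_case_error ::
  "'a measure \<Rightarrow> ('a \<Rightarrow> real) set \<Rightarrow> (('a \<Rightarrow> real) \<Rightarrow> real) \<Rightarrow> (('a \<Rightarrow> real) \<Rightarrow> real) \<Rightarrow> ereal" where
  "worst_case_error M F nrm A = (SUP f\<in>{f \<in> F. nrm f \<le> 1}. ereal \<bar>integral\<^sup>L M f - A f\<bar>)"

definition minimal_error ::
  "'a measure \<Rightarrow> ('a \<Rightarrow> real) set \<Rightarrow> (('a \<Rightarrow> real) \<Rightarrow> real) \<Rightarrow> nat \<Rightarrow> ereal" where
  "minimal_error M F nrm N =
     (INF (a, x)\<in>{(a, x). \<forall>k\<in>{1..N}. 0 \<le> a k \<and> x k \<in> space M}.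
        worst_case_error M F nrm (linear_rule N a x))"

text \<open>The value is \<open>\<infinity>\<close> if no number of nodes suffices.\<close>

definition information_complexity ::
  "'a measure \<Rightarrow> ('a \<Rightarrow> real) set \<Rightarrow> (('a \<Rightarrow> real) \<Rightarrow> real) \<Rightarrow> real \<Rightarrow> enat" where
  "information_complexity M F nrm \<epsilon> =
     Inf (enat ` {N. 1 \<le> N \<and> minimal_error M F nrm N \<le> ereal \<epsilon> * initial_error M F nrm})"

definition is_maximum_on :: "('a \<Rightarrow> real) \<Rightarrow> 'a set \<Rightarrow> real \<Rightarrow> bool" where
  "is_maximum_on f A m \<longleftrightarrow> (\<exists>y\<in>A. f y = m) \<and> (\<forall>y\<in>A. f y \<le> m)"

text \<open>
  The quotients are taken in the extended reals, where \<open>a / 0 = \<infinity>\<close> for \<open>a > 0\<close> and \<open>0 / 0 = 0\<close>.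
  The degenerate case matters because \<open>\<beta> = 0\<close> is possible with \<open>integral\<^sup>L M h > 0\<close>.
\<close>

definition lower_bound_constant ::
  "'a measure \<Rightarrow> (('a \<Rightarrow> real) \<Rightarrow> real) \<Rightarrow> ('a \<Rightarrow> real) \<Rightarrow> real \<Rightarrow> real \<Rightarrow> ereal" where
  "lower_bound_constant M nrm h \<alpha> \<beta> =
     min (ereal (nrm h) / ereal \<alpha>) (ereal (integral\<^sup>L M h) / ereal \<beta>)"

end

theory Submission
  imports Defs
begin

text \<open>
  Fix a positive rule \<open>A\<close> with \<open>N\<close> nodes \<open>x k\<close> and error \<open>E\<close>, and add up the functions
  \<open>s\<close> that belong to its nodes: \<open>g = (\<Sum>k. s (x k))\<close>. At each node \<open>g\<close> dominates the worst-case
  function \<open>h\<close>, so \<open>A h \<le> A g\<close> by positivity, whereas the norm and the integral of \<open>g\<close> are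
  at most \<open>N * \<alpha>\<close> and \<open>N * \<beta>\<close>. Hence
  \<open>I h - E * \<parallel>h\<parallel> \<le> A h \<le> A g \<le> N * \<beta> + E * (N * \<alpha>)\<close>, which bounds \<open>E\<close> from below.
\<close>

section \<open>Lower bounds for positive rules in a normed space of integrable functions\<close>

context normed_integrable_space
begin

lemma sum_mem: "finite K \<Longrightarrow> (\<And>k. k \<in> K \<Longrightarrow> f k \<in> F) \<Longrightarrow> (\<lambda>x. \<Sum>k\<in>K. f k x) \<in> F"
  by (induction K rule: finite_induct) (auto intro: zero_mem add_mem)

lemma norm_zero: "nrm (\<lambda>_. 0) = 0"
  using norm_eq_0[OF zero_mem] by simp

lemma norm_sum_le:
  assumes "finite K" "\<And>k. k \<in> K \<Longrightarrow> f k \<in> F"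
  shows "nrm (\<lambda>x. \<Sum>k\<in>K. f k x) \<le> (\<Sum>k\<in>K. nrm (f k))"
  using assms
proof (induction K rule: finite_induct)
  case empty
  then show ?case by (simp add: norm_zero)
next
  case (insert k K)
  then have "nrm (\<lambda>x. f k x + (\<Sum>k\<in>K. f k x)) \<le> nrm (f k) + nrm (\<lambda>x. \<Sum>k\<in>K. f k x)"
    by (intro norm_triangle sum_mem) auto
  with insert show ?case by force
qed

text \<open>The supremum in the worst-case error runs over the unit ball only; homogeneity of the
  error functional carries the bound to all of \<open>F\<close>. Rescaling fails at norm zero, where
  \<open>f\<close> is the zero function and both sides vanish.\<close>

lemma error_le_worst_case_error:
  assumes f: "f \<in> F" and E: "worst_case_error M F nrm (linear_rule N a x) = ereal E"
  shows "\<bar>integral\<^sup>L M f - linear_rule N a x f\<bar> \<le> E * nrm f"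
proof (cases "nrm f = 0")
  case True
  with f have "f = (\<lambda>_. 0)" by (simp add: norm_eq_0)
  then show ?thesis by (simp add: linear_rule_def norm_zero)
next
  case False
  with norm_nonneg[OF f] have pos: "0 < nrm f" by simp
  let ?g = "\<lambda>x. inverse (nrm f) * f x"
  have "?g \<in> F" "nrm ?g \<le> 1"
    using f pos by (auto simp: norm_scale intro: scale_mem)
  then have "ereal \<bar>integral\<^sup>L M ?g - linear_rule N a x ?g\<bar> \<le> ereal E"
    unfolding E[symmetric] worst_case_error_def by (intro SUP_upper) auto
  moreover have "integral\<^sup>L M ?g - linear_rule N a x ?g =
      inverse (nrm f) * (integral\<^sup>L M f - linear_rule N a x f)"
    by (simp add: linear_rule_def sum_distrib_left algebra_simps)
  ultimately show ?thesis
    using pos by (simp add: abs_mult field_simps)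
qed

lemma worst_case_error_nonneg: "0 \<le> worst_case_error M F nrm A"
  unfolding worst_case_error_def by (rule SUP_upper2[of "\<lambda>_. 0"]) (auto simp: zero_mem norm_zero)

lemma initial_error_nonneg: "0 \<le> initial_error M F nrm"
  unfolding initial_error_def by (rule SUP_upper2[of "\<lambda>_. 0"]) (auto simp: zero_mem norm_zero)

text \<open>Each admissible rule satisfies the chain of inequalities from the introductory comment,
  which is solved for its error. The result depends on neither nodes nor weights, so it passes to
  the infimum.\<close>

lemma minimal_error_ge:
  assumes h: "h \<in> F" "h \<noteq> (\<lambda>_. 0)"
    and S: "\<And>y. y \<in> space M \<Longrightarrow> S y \<in> F"
    and S_nonneg: "\<And>x y. x \<in> space M \<Longrightarrow> y \<in> space M \<Longrightarrow> 0 \<le> S y x"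
    and S_diag: "\<And>y. y \<in> space M \<Longrightarrow> h y \<le> S y y"
    and S_norm: "\<And>y. y \<in> space M \<Longrightarrow> nrm (S y) \<le> \<alpha>"
    and S_integral: "\<And>y. y \<in> space M \<Longrightarrow> integral\<^sup>L M (S y) \<le> \<beta>"
    and "0 \<le> \<alpha>"
  shows "ereal ((integral\<^sup>L M h - real N * \<beta>) / (real N * \<alpha> + nrm h)) \<le> minimal_error M F nrm N"
  unfolding minimal_error_def
proof (rule INF_greatest, clarify)
  fix a :: "nat \<Rightarrow> real" and x :: "nat \<Rightarrow> 'a"
  assume ax: "\<forall>k\<in>{1..N}. 0 \<le> a k \<and> x k \<in> space M"
  let ?A = "linear_rule N a x" and ?g = "\<lambda>z. \<Sum>k=1..N. S (x k) z"
  \<comment> \<open>Since \<open>h\<close> is nonzero, definiteness of the norm keeps the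
    denominator positive even for \<open>N = 0\<close>.\<close>
  have pos: "0 < real N * \<alpha> + nrm h"
    using h norm_nonneg[OF h(1)] norm_eq_0[OF h(1)] \<open>0 \<le> \<alpha>\<close>
    by (simp add: add_nonneg_pos)
  show "ereal ((integral\<^sup>L M h - real N * \<beta>) / (real N * \<alpha> + nrm h)) \<le> worst_case_error M F nrm ?A"
  proof (cases "worst_case_error M F nrm ?A")
    \<comment> \<open>Only a finite error needs an argument: the bound is trivial for an infinite
      one, and nonnegativity excludes minus infinity.\<close>
    case (real E)
    then have "0 \<le> E" using worst_case_error_nonneg[of ?A] by simp
    have g: "?g \<in> F" using ax S by (intro sum_mem) auto
    have "nrm ?g \<le> (\<Sum>k=1..N. nrm (S (x k)))"
      using ax S by (intro norm_sum_le) auto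
    also have "\<dots> \<le> (\<Sum>k=1..N. \<alpha>)" using ax S_norm by (intro sum_mono) auto
    finally have norm_g: "nrm ?g \<le> real N * \<alpha>" by simp
    have "integral\<^sup>L M ?g = (\<Sum>k=1..N. integral\<^sup>L M (S (x k)))"
      using ax S by (intro Bochner_Integration.integral_sum integrable) auto
    also have "\<dots> \<le> (\<Sum>k=1..N. \<beta>)" using ax S_integral by (intro sum_mono) auto
    finally have integral_g: "integral\<^sup>L M ?g \<le> real N * \<beta>" by simp
    have "?A h \<le> ?A ?g"
      unfolding linear_rule_def
    proof (intro sum_mono mult_left_mono)
      fix k assume k: "k \<in> {1..N}"
      have "h (x k) \<le> S (x k) (x k)" using ax k S_diag by auto
      \<comment> \<open>The other summands are nonnegative at \<open>x k\<close>. The sum runs over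
        indices, so repeated nodes do no harm.\<close>
      also have "\<dots> \<le> ?g (x k)" using ax k S_nonneg by (intro member_le_sum) auto
      finally show "h (x k) \<le> ?g (x k)" .
    qed (use ax in auto)
    moreover have "\<bar>integral\<^sup>L M h - ?A h\<bar> \<le> E * nrm h"
      by (rule error_le_worst_case_error[OF h(1) real])
    moreover have "\<bar>integral\<^sup>L M ?g - ?A ?g\<bar> \<le> E * nrm ?g"
      by (rule error_le_worst_case_error[OF g real])
    moreover have "E * nrm ?g \<le> E * (real N * \<alpha>)"
      using norm_g \<open>0 \<le> E\<close> by (rule mult_left_mono)
    ultimately have "integral\<^sup>L M h - real N * \<beta> \<le> E * (real N * \<alpha> + nrm h)"
      using integral_g by (simp add: distrib_left)
    then show ?thesis using pos real by (simp add: pos_divide_le_eq)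
  qed (use worst_case_error_nonneg[of ?A] in auto)
qed

text \<open>For a worst-case \<open>h\<close> the integral is \<open>nrm h\<close> times the initial
  error, so the lower bound for the minimal error can be compared with \<open>\<epsilon>\<close>
  times the initial error. The factor obtained is
  \<open>(1 - \<epsilon>) / (1 + \<epsilon>)\<close>, which is at least
  \<open>1 - 2 * \<epsilon>\<close>.\<close>

lemma information_complexity_ge:
  assumes h: "worst_case_function M F nrm h"
    and S: "\<And>y. y \<in> space M \<Longrightarrow> S y \<in> F"
    and S_nonneg: "\<And>x y. x \<in> space M \<Longrightarrow> y \<in> space M \<Longrightarrow> 0 \<le> S y x"
    and S_diag: "\<And>y. y \<in> space M \<Longrightarrow> S y y = h y"
    and S_norm: "\<And>y. y \<in> space M \<Longrightarrow> nrm (S y) \<le> \<alpha>"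
    and S_integral: "\<And>y. y \<in> space M \<Longrightarrow> integral\<^sup>L M (S y) \<le> \<beta>"
    and \<epsilon>: "0 < \<epsilon>" "\<epsilon> < 1 / 2"
  shows "lower_bound_constant M nrm h \<alpha> \<beta> * ereal (1 - 2 * \<epsilon>) \<le>
      ereal_of_enat (information_complexity M F nrm \<epsilon>)"
proof -
  define e where "e = initial_error M F nrm"
  have hF: "h \<in> F" and I: "ereal (integral\<^sup>L M h) = ereal (nrm h) * e"
    using h by (auto simp: worst_case_function_def e_def)
  have "0 \<le> e" using initial_error_nonneg by (simp add: e_def)
  show ?thesis
  proof (cases "integral\<^sup>L M h = 0")
    \<comment> \<open>The second quotient is then 0, also for \<open>\<beta> = 0\<close> because
      \<open>0 / 0 = 0\<close>, and the claim is trivial.\<close>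
    case True
    then have "lower_bound_constant M nrm h \<alpha> \<beta> \<le> 0"
      by (simp add: lower_bound_constant_def min.coboundedI2 flip: zero_ereal_def)
    then have "lower_bound_constant M nrm h \<alpha> \<beta> * ereal (1 - 2 * \<epsilon>) \<le> 0"
      using \<epsilon> by (simp add: ereal_mult_le_0_iff)
    also have "0 \<le> ereal_of_enat (information_complexity M F nrm \<epsilon>)" by simp
    finally show ?thesis .
  next
    case False
    then have h0: "h \<noteq> (\<lambda>_. 0)" by auto
    then have n: "0 < nrm h" using norm_nonneg[OF hF] norm_eq_0[OF hF] by simp
    \<comment> \<open>An infinite initial error would make the product with \<open>nrm h > 0\<close>
      infinite, but this product is the real integral of \<open>h\<close>.\<close>
    obtain e' where e': "e = ereal e'" using I n \<open>0 \<le> e\<close> by (cases e) auto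
    have Ie: "integral\<^sup>L M h = nrm h * e'" using I e' by simp
    have "0 < e'" using Ie False \<open>0 \<le> e\<close> e' by (cases "e' = 0") auto
    \<comment> \<open>At a point where \<open>h\<close> does not vanish, \<open>S y\<close> is a
      nonzero function, which forces \<open>\<alpha> > 0\<close>. Its integral may still be 0, so
      only \<open>\<beta> \<ge> 0\<close> follows.\<close>
    obtain y where y: "h y \<noteq> 0" using h0 by auto
    then have yM: "y \<in> space M" using vanishes_outside[OF hF] by blast
    have "S y \<noteq> (\<lambda>_. 0)" using S_diag[OF yM] y by auto
    then have "0 < nrm (S y)"
      using norm_nonneg[OF S[OF yM]] norm_eq_0[OF S[OF yM]] by simp
    with S_norm[OF yM] have \<alpha>: "0 < \<alpha>" by simp
    have "0 \<le> integral\<^sup>L M (S y)" using S_nonneg yM by (intro integral_nonneg_AE) auto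
    with S_integral[OF yM] have \<beta>: "0 \<le> \<beta>" by simp
    have *: "lower_bound_constant M nrm h \<alpha> \<beta> * ereal (1 - 2 * \<epsilon>) \<le> ereal (real N)"
      if N: "minimal_error M F nrm N \<le> ereal \<epsilon> * initial_error M F nrm" for N
    proof -
      have "ereal ((integral\<^sup>L M h - real N * \<beta>) / (real N * \<alpha> + nrm h)) \<le> minimal_error M F nrm N"
        using hF h0 S S_nonneg S_diag S_norm S_integral \<alpha> by (intro minimal_error_ge[where S = S]) auto
      also note N
      finally have "(integral\<^sup>L M h - real N * \<beta>) / (real N * \<alpha> + nrm h) \<le> \<epsilon> * e'"
        by (simp add: e' flip: e_def)
      moreover have "0 < real N * \<alpha> + nrm h" using n \<alpha> by (simp add: add_nonneg_pos)
      ultimately have bound: "nrm h * e' - real N * \<beta> \<le> \<epsilon> * e' * (real N * \<alpha> + nrm h)"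
        by (simp add: pos_divide_le_eq Ie)
      \<comment> \<open>The conditions on \<open>c\<close> say that it is below both quotients, but
        without division, so that they also make sense for \<open>\<beta> = 0\<close>.\<close>
      have real_bound: "c * (1 - 2 * \<epsilon>) \<le> real N"
        if c: "0 \<le> c" "c * \<alpha> \<le> nrm h" "c * \<beta> \<le> nrm h * e'" for c
      proof -
        have "c * (nrm h * e' * (1 - \<epsilon>)) \<le> c * (real N * \<beta> + \<epsilon> * e' * (real N * \<alpha>))"
          using bound c(1) by (intro mult_left_mono) (simp_all add: algebra_simps)
        also have "\<dots> = real N * (c * \<beta>) + real N * \<epsilon> * e' * (c * \<alpha>)"
          by (simp add: algebra_simps)
        \<comment> \<open>Inserting the two conditions on \<open>c\<close> produces the common
          factor \<open>nrm h * e'\<close> on both sides; it is positive and cancels.\<close>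
        also have "\<dots> \<le> real N * (nrm h * e') + real N * \<epsilon> * e' * nrm h"
          using c \<epsilon> \<open>0 < e'\<close> by (intro add_mono mult_left_mono) auto
        finally have "(nrm h * e') * (c * (1 - \<epsilon>)) \<le> (nrm h * e') * (real N * (1 + \<epsilon>))"
          by (simp add: algebra_simps)
        then have "c * (1 - \<epsilon>) \<le> real N * (1 + \<epsilon>)"
          using n \<open>0 < e'\<close> by simp
        moreover have "c * (1 - 2 * \<epsilon>) * (1 + \<epsilon>) \<le> c * (1 - \<epsilon>)"
        proof -
          \<comment> \<open>The difference of the two sides is
            \<open>2 * \<epsilon>^2\<close>.\<close>
          have "(1 - 2 * \<epsilon>) * (1 + \<epsilon>) \<le> 1 - \<epsilon>" by (simp add: algebra_simps)
          from mult_left_mono[OF this c(1)] show ?thesis by (simp add: mult.assoc)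
        qed
        ultimately have "c * (1 - 2 * \<epsilon>) * (1 + \<epsilon>) \<le> real N * (1 + \<epsilon>)" by linarith
        then show ?thesis using \<epsilon> by simp
      qed
      show ?thesis
      proof (cases "\<beta> = 0")
        \<comment> \<open>The integral of \<open>h\<close> is positive, so the second quotient is
          infinite and the first one alone serves as \<open>c\<close>.\<close>
        case True
        have "lower_bound_constant M nrm h \<alpha> \<beta> * ereal (1 - 2 * \<epsilon>) \<le> ereal (nrm h / \<alpha>) * ereal (1 - 2 * \<epsilon>)"
          using \<alpha> \<epsilon> by (intro ereal_mult_right_mono) (auto simp: lower_bound_constant_def)
        also have "\<dots> \<le> ereal (real N)"
          using real_bound[of "nrm h / \<alpha>"] n \<alpha> \<open>0 < e'\<close> True by simp
        finally show ?thesis .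
      next
        case False
        let ?c = "min (nrm h / \<alpha>) (integral\<^sup>L M h / \<beta>)"
        have "lower_bound_constant M nrm h \<alpha> \<beta> = ereal ?c"
          using \<alpha> False by (simp add: lower_bound_constant_def)
        moreover have "?c * (1 - 2 * \<epsilon>) \<le> real N"
        proof (rule real_bound)
          show "0 \<le> ?c" using n \<alpha> \<beta> \<open>0 < e'\<close> by (simp add: Ie)
          show "?c * \<alpha> \<le> nrm h" using \<alpha> by (simp flip: pos_le_divide_eq)
          show "?c * \<beta> \<le> nrm h * e'" using \<beta> False by (simp add: Ie flip: pos_le_divide_eq)
        qed
        ultimately show ?thesis by (simp only: times_ereal.simps(1) ereal_less_eq(3))
      qed
    qed
    define X where "X = {N. 1 \<le> N \<and> minimal_error M F nrm N \<le> ereal \<epsilon> * initial_error M F nrm}"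
    show ?thesis
    proof (cases "X = {}")
      case True
      then have "information_complexity M F nrm \<epsilon> = \<infinity>"
        unfolding information_complexity_def X_def[symmetric] by (simp add: top_enat_def)
      then show ?thesis by simp
    next
      case False
      then obtain m where "m \<in> enat ` X" by blast
      \<comment> \<open>The infimum is attained by well-ordering, so \<open>*\<close> applies to the
        attaining \<open>N\<close>.\<close>
      then have "Inf (enat ` X) \<in> enat ` X" by (rule wellorder_InfI)
      then obtain N where "N \<in> X" "Inf (enat ` X) = enat N" by auto
      then show ?thesis
        using *[of N] by (simp add: information_complexity_def X_def)
    qed
  qed
qed

end

section \<open>Integrals of elementary tensors over the box\<close>

lemma AE_PiM_component:
  fixes M :: "'i \<Rightarrow> 'a measure"
  assumes "\<And>i. sigma_finite_measure (M i)" and "finite I" "j \<in> I" and AE: "AE x in M j. P x"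
  shows "AE x in Pi\<^sub>M I M. P (x j)"
proof -
  interpret product_sigma_finite M using assms(1) by (simp add: product_sigma_finite_def)
  obtain Z where Z: "{x \<in> space (M j). \<not> P x} \<subseteq> Z" "emeasure (M j) Z = 0" "Z \<in> sets (M j)"
    using AE by (rule AE_E)
  \<comment> \<open>The exceptional set lies in a box with the null set \<open>Z\<close> as factor
    \<open>j\<close> and full factors elsewhere. Its measure is 0 even if other factors have
    infinite measure, as \<open>0 * \<infinity> = 0\<close>.\<close>
  let ?Z = "\<lambda>i. if i = j then Z else space (M i)"
  show ?thesis
  proof (rule AE_I)
    show "{x \<in> space (Pi\<^sub>M I M). \<not> P (x j)} \<subseteq> Pi\<^sub>E I ?Z"
      using Z(1) \<open>j \<in> I\<close> by (auto simp: space_PiM PiE_iff extensional_def split: if_splits)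
    show "Pi\<^sub>E I ?Z \<in> sets (Pi\<^sub>M I M)"
      using Z(3) \<open>finite I\<close> by (intro sets_PiM_I_finite) auto
    have "emeasure (Pi\<^sub>M I M) (Pi\<^sub>E I ?Z) = (\<Prod>i\<in>I. emeasure (M i) (?Z i))"
      using Z(3) \<open>finite I\<close> by (intro emeasure_PiM) auto
    also have "\<dots> = 0"
      using \<open>finite I\<close> \<open>j \<in> I\<close> Z(2) by (intro prod_zero bexI[of _ j]) auto
    finally show "emeasure (Pi\<^sub>M I M) (Pi\<^sub>E I ?Z) = 0" .
  qed
qed

lemma space_box_measure: "space (box_measure d D) = Pi\<^sub>E {1..d} D"
  by (auto simp: box_measure_def space_restrict_space space_PiM)

text \<open>This is Fubini's theorem, but the factors are only Lebesgue measurable and the box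
  carries a completed product measure. Each factor is therefore replaced by an almost everywhere
  equal Borel function, and Fubini is applied to the uncompleted product of
  \<open>lborel\<close>.\<close>

lemma integral_tensor:
  assumes D: "\<And>j. j \<in> {1..d} \<Longrightarrow> D j \<in> sets borel"
    and int: "\<And>j. j \<in> {1..d} \<Longrightarrow> integrable (lebesgue_on (D j)) (f j)"
    and van: "\<And>j x. j \<in> {1..d} \<Longrightarrow> x \<notin> D j \<Longrightarrow> f j x = 0"
    and int_tensor: "integrable (box_measure d D) (tensor d D f)"
  shows "integral\<^sup>L (box_measure d D) (tensor d D f) = (\<Prod>j=1..d. integral\<^sup>L (lebesgue_on (D j)) (f j))"
proof -
  let ?P = "Pi\<^sub>M {1..d} (\<lambda>_. lborel :: real measure)"
  interpret product_sigma_finite "\<lambda>_::nat. lborel :: real measure"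
    by (simp add: product_sigma_finite_def lborel.sigma_finite_measure_axioms)
  have "\<exists>g. g \<in> borel_measurable lborel \<and> (AE x in lborel. f j x = g x) \<and> integrable lborel g \<and>
      integral\<^sup>L lborel g = integral\<^sup>L (lebesgue_on (D j)) (f j)" if j: "j \<in> {1..d}" for j
  proof -
    have DL: "D j \<inter> space lebesgue \<in> sets lebesgue" using D[OF j] by auto
    \<comment> \<open>Thanks to the extension by zero, integration over \<open>D j\<close> is
      integration over the whole line.\<close>
    have ind: "(\<lambda>x. indicat_real (D j) x * f j x) = f j"
      using van[OF j] by (auto simp: indicator_def fun_eq_iff)
    have intL: "integrable lebesgue (f j)"
      using int[OF j] by (simp add: integrable_restrict_space[OF DL] set_integrable_def ind)
    have eqL: "integral\<^sup>L (lebesgue_on (D j)) (f j) = integral\<^sup>L lebesgue (f j)"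
      by (simp add: integral_restrict_space[OF DL] set_lebesgue_integral_def ind)
    have "f j \<in> borel_measurable (completion lborel)" using intL by simp
    from completion_ex_borel_measurable_real[OF this] obtain g
      where g: "g \<in> borel_measurable lborel" "AE x in lborel. f j x = g x" by auto
    have AE: "AE x in lebesgue. f j x = g x" using g(2) by (rule AE_completion)
    have gL: "g \<in> borel_measurable lebesgue" using g(1) by (rule measurable_completion)
    have "integrable lebesgue g"
      using intL AE gL by (subst integrable_cong_AE[symmetric, of "f j"]) auto
    then have "integrable lborel g" using g(1) by (simp add: integrable_completion)
    moreover have "integral\<^sup>L lborel g = integral\<^sup>L lebesgue (f j)"
      using g(1) intL AE gL by (subst integral_completion[symmetric]) (auto intro!: integral_cong_AE)
    ultimately show ?thesis using g eqL by (intro exI[of _ g]) simp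
  qed
  then obtain g where g: "\<And>j. j \<in> {1..d} \<Longrightarrow> g j \<in> borel_measurable lborel"
      "\<And>j. j \<in> {1..d} \<Longrightarrow> AE x in lborel. f j x = g j x"
      "\<And>j. j \<in> {1..d} \<Longrightarrow> integrable lborel (g j)"
      "\<And>j. j \<in> {1..d} \<Longrightarrow> integral\<^sup>L lborel (g j) = integral\<^sup>L (lebesgue_on (D j)) (f j)"
    by metis
  let ?G = "\<lambda>x. \<Prod>j=1..d. g j (x j)"
  have "Pi\<^sub>E {1..d} D \<in> sets ?P" using D by (intro sets_PiM_I_finite) auto
  then have DP: "Pi\<^sub>E {1..d} D \<inter> space (completion ?P) \<in> sets (completion ?P)"
    by (auto intro: sets.Int)
  have ind: "(\<lambda>x. indicat_real (Pi\<^sub>E {1..d} D) x * tensor d D f x) = tensor d D f"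
    by (auto simp: tensor_def indicator_def fun_eq_iff)
  have intP: "integrable (completion ?P) (tensor d D f)"
    using int_tensor
    by (simp only: box_measure_def integrable_restrict_space[OF DP] set_integrable_def real_scaleR_def ind)
  have G: "?G \<in> borel_measurable ?P"
  proof (rule borel_measurable_prod)
    fix j assume j: "j \<in> {1..d}"
    show "(\<lambda>x. g j (x j)) \<in> borel_measurable ?P"
      using measurable_compose[OF measurable_component_singleton[OF j] g(1)[OF j]] .
  qed
  have "AE x in ?P. \<forall>j\<in>{1..d}. f j (x j) = g j (x j)"
    using g(2) by (intro AE_finite_allI AE_PiM_component) (auto simp: lborel.sigma_finite_measure_axioms)
  then have "AE x in ?P. tensor d D f x = ?G x"
    using AE_space
  proof eventually_elim
    case (elim x)
    have "tensor d D f x = (\<Prod>j=1..d. f j (x j))"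
    proof (cases "x \<in> Pi\<^sub>E {1..d} D")
      \<comment> \<open>Here \<open>x\<close> is extensional, so leaving the box means that some
        coordinate leaves its domain, and the corresponding factor is zero.\<close>
      case False
      then obtain j where "j \<in> {1..d}" "x j \<notin> D j"
        using elim(2) by (auto simp: space_PiM PiE_iff)
      then have "(\<Prod>j=1..d. f j (x j)) = 0" using van by (intro prod_zero bexI[of _ j]) auto
      with False show ?thesis by (simp add: tensor_def)
    qed (simp add: tensor_def)
    with elim(1) show ?case by simp
  qed
  then have AE: "AE x in completion ?P. tensor d D f x = ?G x" by (rule AE_completion)
  have "integral\<^sup>L (box_measure d D) (tensor d D f) = integral\<^sup>L (completion ?P) (tensor d D f)"
    by (simp only: box_measure_def integral_restrict_space[OF DP] set_lebesgue_integral_def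
        real_scaleR_def ind)
  also have "\<dots> = integral\<^sup>L (completion ?P) ?G"
    using intP G AE by (intro integral_cong_AE) (auto intro: measurable_completion)
  also have "\<dots> = integral\<^sup>L ?P ?G" using G by (rule integral_completion)
  also have "\<dots> = (\<Prod>j=1..d. integral\<^sup>L lborel (g j))"
    using g(3) by (intro product_integral_prod) auto
  also have "\<dots> = (\<Prod>j=1..d. integral\<^sup>L (lebesgue_on (D j)) (f j))"
    using g(4) by (intro prod.cong) auto
  finally show ?thesis .
qed

section \<open>Application to tensor product spaces\<close>

lemma (in tensor_product_space) tensor_mem:
  assumes "\<And>j. j \<in> {1..d} \<Longrightarrow> f j \<in> F j"
  shows "tensor d D f \<in> Fd"
proof -
  have "\<exists>(n::nat) g. tensor d D f = (\<lambda>x. \<Sum>i<n. tensor d D (g i) x) \<and> (\<forall>i<n. \<forall>j\<in>{1..d}. g i j \<in> F j)"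
    using assms by (intro exI[of _ "1::nat"] exI[of _ "\<lambda>_. f"]) auto
  then have "tensor d D f \<in> algebraic_tensor_product d D F"
    unfolding algebraic_tensor_product_def by blast
  then show ?thesis using algebraic_subset by blast
qed

theorem theorem6:
  fixes D :: "nat \<Rightarrow> real set"
    and F :: "nat \<Rightarrow> (real \<Rightarrow> real) set"
    and nrm :: "nat \<Rightarrow> (real \<Rightarrow> real) \<Rightarrow> real"
    and Fd :: "nat \<Rightarrow> ((nat \<Rightarrow> real) \<Rightarrow> real) set"
    and nrmd :: "nat \<Rightarrow> ((nat \<Rightarrow> real) \<Rightarrow> real) \<Rightarrow> real"
    and h :: "nat \<Rightarrow> real \<Rightarrow> real"
    and s :: "nat \<Rightarrow> real \<Rightarrow> real \<Rightarrow> real"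
    and \<alpha> \<beta> :: "nat \<Rightarrow> real"
    and d :: nat and \<epsilon> :: real
  assumes "\<And>j. 1 \<le> j \<Longrightarrow> D j \<in> sets borel"
    and "\<And>j. 1 \<le> j \<Longrightarrow> normed_integrable_space (lebesgue_on (D j)) (F j) (nrm j)"
    and "\<And>n. 1 \<le> n \<Longrightarrow> tensor_product_space n D F nrm (Fd n) (nrmd n)"
    and "1 \<le> d"
    and "\<And>j. j \<in> {1..d} \<Longrightarrow> worst_case_function (lebesgue_on (D j)) (F j) (nrm j) (h j)"
    and "worst_case_function (box_measure d D) (Fd d) (nrmd d) (tensor d D h)"
    and "\<And>j y. j \<in> {1..d} \<Longrightarrow> y \<in> D j \<Longrightarrow>
           s j y \<in> F j \<and> (\<forall>x\<in>D j. 0 \<le> s j y x) \<and> s j y y = h j y"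
    and "\<And>j. j \<in> {1..d} \<Longrightarrow> is_maximum_on (\<lambda>y. nrm j (s j y)) (D j) (\<alpha> j)"
    and "\<And>j. j \<in> {1..d} \<Longrightarrow>
           is_maximum_on (\<lambda>y. integral\<^sup>L (lebesgue_on (D j)) (s j y)) (D j) (\<beta> j)"
    and "0 < \<epsilon>" and "\<epsilon> < 1 / 2"
  shows "ereal_of_enat (information_complexity (box_measure d D) (Fd d) (nrmd d) \<epsilon>) \<ge>
           lower_bound_constant (box_measure d D) (nrmd d) (tensor d D h)
             (\<Prod>j=1..d. \<alpha> j) (\<Prod>j=1..d. \<beta> j) * ereal (1 - 2 * \<epsilon>)"
proof -
  interpret T: tensor_product_space d D F nrm "Fd d" "nrmd d" using assms(3,4) by simp
  have N: "normed_integrable_space (lebesgue_on (D j)) (F j) (nrm j)" if "j \<in> {1..d}" for j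
    using assms(2) that by simp
  \<comment> \<open>The dominating function at a node \<open>y\<close> is the tensor of the
    univariate ones at its coordinates: the crossnorm factorises its norm, and
    \<open>integral_tensor\<close> its integral.\<close>
  define S where "S y = tensor d D (\<lambda>j. s j (y j))" for y
  \<comment> \<open>The lower bounds 0 are recorded because multiplying the coordinatewise upper
    bounds requires nonnegative factors.\<close>
  have s: "s j (y j) \<in> F j" "0 \<le> nrm j (s j (y j))" "nrm j (s j (y j)) \<le> \<alpha> j"
      "0 \<le> integral\<^sup>L (lebesgue_on (D j)) (s j (y j))"
      "integral\<^sup>L (lebesgue_on (D j)) (s j (y j)) \<le> \<beta> j"
    if "y \<in> Pi\<^sub>E {1..d} D" "j \<in> {1..d}" for y j
  proof -
    have y: "y j \<in> D j" using that by auto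
    show "s j (y j) \<in> F j" using assms(7)[OF that(2) y] by simp
    then show "0 \<le> nrm j (s j (y j))" by (rule normed_integrable_space.norm_nonneg[OF N[OF that(2)]])
    show "nrm j (s j (y j)) \<le> \<alpha> j" using assms(8)[OF that(2)] y by (simp add: is_maximum_on_def)
    show "0 \<le> integral\<^sup>L (lebesgue_on (D j)) (s j (y j))"
      using assms(7)[OF that(2) y] by (intro integral_nonneg_AE) (auto simp: space_restrict_space)
    show "integral\<^sup>L (lebesgue_on (D j)) (s j (y j)) \<le> \<beta> j"
      using assms(9)[OF that(2)] y by (simp add: is_maximum_on_def)
  qed
  show ?thesis
  proof (rule T.information_complexity_ge[where S = S])
    fix y assume "y \<in> space (box_measure d D)"
    then have y: "y \<in> Pi\<^sub>E {1..d} D" by (simp add: space_box_measure)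
    show SF: "S y \<in> Fd d" unfolding S_def using s(1)[OF y] by (rule T.tensor_mem)
    have "(\<Prod>j=1..d. s j (y j) (y j)) = (\<Prod>j=1..d. h j (y j))"
      using assms(7) y by (intro prod.cong) (auto simp: PiE_iff)
    then show "S y y = tensor d D h y" by (simp add: S_def tensor_def)
    have "nrmd d (S y) = (\<Prod>j=1..d. nrm j (s j (y j)))"
      unfolding S_def by (rule T.crossnorm) (rule s(1)[OF y])
    also have "\<dots> \<le> (\<Prod>j=1..d. \<alpha> j)" using s(2,3)[OF y] by (intro prod_mono) auto
    finally show "nrmd d (S y) \<le> (\<Prod>j=1..d. \<alpha> j)" .
    have "integral\<^sup>L (box_measure d D) (S y) = (\<Prod>j=1..d. integral\<^sup>L (lebesgue_on (D j)) (s j (y j)))"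
      unfolding S_def
    proof (rule integral_tensor)
      fix j assume j: "j \<in> {1..d}"
      show "D j \<in> sets borel" using assms(1) j by simp
      show "integrable (lebesgue_on (D j)) (s j (y j))"
        by (rule normed_integrable_space.integrable[OF N[OF j] s(1)[OF y j]])
      show "s j (y j) x = 0" if "x \<notin> D j" for x
        using normed_integrable_space.vanishes_outside[OF N[OF j] s(1)[OF y j]] that
        by (simp add: space_restrict_space)
    qed (use T.integrable[OF SF] in \<open>simp add: S_def\<close>)
    also have "\<dots> \<le> (\<Prod>j=1..d. \<beta> j)" using s(4,5)[OF y] by (intro prod_mono) auto
    finally show "integral\<^sup>L (box_measure d D) (S y) \<le> (\<Prod>j=1..d. \<beta> j)" .
  next
    fix x y assume "x \<in> space (box_measure d D)" "y \<in> space (box_measure d D)"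
    then show "0 \<le> S y x"
      using assms(7) by (auto simp: S_def tensor_def space_box_measure PiE_iff intro!: prod_nonneg)
  qed (use assms in auto)
qed

end
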